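(* Let $p(z)=a_0z^n+a_1z^{n-1}+\cdots+a_n$ be a polynomial of degree $n\ge1$ with real coefficients, $a_0>0$. Then $p$ has only nonpositive (real) zeros if and only if the $2n\times 2n$ matrix $$\mathcal D_{2n}(p)=\begin{pmatrix} na_0&(n-1)a_1&(n-2)a_2&\dots&a_{n-1}&0&\dots&0&0\\ a_0&a_1&a_2&\dots&a_{n-1}&a_n&\dots&0&0\\ 0&na_0&(n-1)a_1&\dots&2a_{n-2}&a_{n-1}&\dots&0&0\\ 0&a_0&a_1&\dots&a_{n-2}&a_{n-1}&\dots&0&0\\ \vdots&\vdots&\vdots&\ddots&\vdots&\vdots&\ddots&\vdots&\vdots\\ 0&0&0&\dots&na_0&(n-1)a_1&\dots&a_{n-1}&0\\ 0&0&0&\dots&a_0&a_1&\dots&a_{n-1}&a_n \end{pmatrix}$$ is totally nonnegative.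
   Context: Set $a_i=0$ for $i<0$ and $i>n$. With rows and columns numbered from 1, for $i=1,\ldots,n$ and $c=1,\ldots,2n$, the entry of $\mathcal D_{2n}(p)$ in row $2i-1$, column $c$ is $(n-c+i)\,a_{c-i}$, and in row $2i$, column $c$ is $a_{c-i}$. A matrix is totally nonnegative if all its minors are nonnegative. *)

theory Defs
  imports
    "HOL-Computational_Algebra.Polynomial"
    "Jordan_Normal_Form.Determinant"
    "Jordan_Normal_Form.DL_Submatrix"
    Complex_Main
begin

text \<open>
  Coefficients are numbered from the leading one downwards,
  \<open>p(z) = a\<^sub>0 z\<^sup>n + a\<^sub>1 z\<^sup>n\<^sup>-\<^sup>1 + \<dots> + a\<^sub>n\<close> with \<open>n = degree p\<close>, and extended by zero
  to all integer indices.
\<close>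

definition acoeff :: "real poly \<Rightarrow> int \<Rightarrow> real" where
  "acoeff p i =
     (if 0 \<le> i \<and> i \<le> int (degree p) then poly.coeff p (degree p - nat i) else 0)"

text \<open>
  Matrix indices start at 0, so the 0-based row \<open>r\<close> belongs to the pair of 1-based rows
  \<open>2i - 1\<close>, \<open>2i\<close> with \<open>i = r div 2 + 1\<close>, and it is the row \<open>2i - 1\<close> iff \<open>r\<close> is even.
\<close>

definition D_mat :: "real poly \<Rightarrow> real mat" where
  "D_mat p = mat (2 * degree p) (2 * degree p) (\<lambda>(r, s).
     let i = int (r div 2) + 1; c = int s + 1 in
       if even r then of_int (int (degree p) - c + i) * acoeff p (c - i)
       else acoeff p (c - i))"

definition totally_nonnegative :: "real mat \<Rightarrow> bool" where
  "totally_nonnegative A \<longleftrightarrow>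
     (\<forall>I J. I \<subseteq> {..<dim_row A} \<and> J \<subseteq> {..<dim_col A} \<and> card I = card J
        \<longrightarrow> 0 \<le> det (submatrix A I J))"

end

theory Submission
  imports Defs "HOL-Computational_Algebra.Fundamental_Theorem_Algebra"
begin

text \<open>
  Put \<open>v(t) = a\<^sub>0 + a\<^sub>1 t + \<dots> + a\<^sub>n t\<^sup>n\<close> and \<open>u = n v - t v'\<close>. The rows of the matrix are, alternately,
  the shifted coefficient sequences of \<open>u\<close> and of \<open>v\<close>. Both properties of \<open>p\<close> turn out to be
  equivalent to the success of a Euclidean algorithm with positive quotients,
  \<open>v = c u + t u'\<close> with \<open>c > 0\<close>, then the same for \<open>(u', u)\<close>, until a pair \<open>(0, e)\<close> is reached.

  Each such step is a Schur complement of the leading entry, up to a unit lower triangular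
  factor. Conversely, undoing a step adds nonnegative multiples of rows to the next ones, and the
  matrix of \<open>(0, e)\<close> is totally nonnegative for a product \<open>e\<close> of factors \<open>1 + y t\<close>, \<open>y \<ge> 0\<close>.

  If the algorithm succeeds, then \<open>u / v\<close> maps the upper half plane to the closed sector
  \<open>Im w \<le> 0 \<le> Im (t w)\<close> after cancelling \<open>e\<close>, so that every nonreal zero of \<open>v\<close> is a zero of \<open>e\<close>
  of the same multiplicity, which is impossible since \<open>e\<close> divides \<open>t v'\<close>. If
  \<open>v = a\<^sub>0 \<Prod> (1 + x\<^sub>j t)\<close> with \<open>x\<^sub>j \<ge> 0\<close>, then the successive remainders are
  \<open>v \<Sum> x\<^sub>j\<^sup>k\<^sup>/\<^sup>2 R\<^sub>k(\<surd>x\<^sub>j) / (1 + x\<^sub>j t)\<close> with polynomials \<open>R\<^sub>k\<close> orthogonal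
  with respect to the counting measure of the points \<open>\<plusminus>\<surd>x\<^sub>j\<close>; the quotients are positive
  because their values at \<open>t = 0\<close> are squared norms.
\<close>

subsection \<open>Total nonnegativity of indexed families\<close>

text \<open>Rows and columns are selected by index functions, so that one notion covers finite
  sections and doubly infinite matrices, and repeated rows may occur in intermediate
  determinants.\<close>

definition minor :: "('a \<Rightarrow> 'b \<Rightarrow> real) \<Rightarrow> nat \<Rightarrow> (nat \<Rightarrow> 'a) \<Rightarrow> (nat \<Rightarrow> 'b) \<Rightarrow> real" where
  "minor A k r c = det (mat k k (\<lambda>(i, j). A (r i) (c j)))"

definition tnn_on :: "'a::linorder set \<Rightarrow> 'b::linorder set \<Rightarrow> ('a \<Rightarrow> 'b \<Rightarrow> real) \<Rightarrow> bool" where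
  "tnn_on R C A \<longleftrightarrow>
     (\<forall>k r c. strict_mono_on {..<k} r \<longrightarrow> strict_mono_on {..<k} c \<longrightarrow>
        r ` {..<k} \<subseteq> R \<longrightarrow> c ` {..<k} \<subseteq> C \<longrightarrow> 0 \<le> minor A k r c)"

lemma tnn_onI:
  assumes "\<And>k r c. strict_mono_on {..<k} r \<Longrightarrow> strict_mono_on {..<k} c \<Longrightarrow>
    r ` {..<k} \<subseteq> R \<Longrightarrow> c ` {..<k} \<subseteq> C \<Longrightarrow> 0 \<le> minor A k r c"
  shows "tnn_on R C A"
  using assms by (auto simp: tnn_on_def)

lemma tnn_onD:
  assumes "tnn_on R C A" "strict_mono_on {..<k} r" "strict_mono_on {..<k} c"
    "r ` {..<k} \<subseteq> R" "c ` {..<k} \<subseteq> C"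
  shows "0 \<le> minor A k r c"
  using assms by (auto simp: tnn_on_def)

lemma minor_cong:
  fixes k :: nat
  assumes "\<And>i j. i < k \<Longrightarrow> j < k \<Longrightarrow> A (r i) (c j) = B (r' i) (c' j)"
  shows "minor A k r c = minor B k r' c'"
  unfolding minor_def by (rule arg_cong[where f = det], rule eq_matI) (use assms in auto)

lemma minor_transpose: "minor (\<lambda>i j. A j i) k c r = minor A k r c"
proof -
  have "mat k k (\<lambda>(i, j). A (r j) (c i)) = (mat k k (\<lambda>(i, j). A (r i) (c j)))\<^sup>T"
    by (rule eq_matI) auto
  then show ?thesis
    unfolding minor_def by (metis det_transpose mat_carrier)
qed

lemma tnn_on_transpose: "tnn_on C R (\<lambda>i j. A j i) \<longleftrightarrow> tnn_on R C A"
  unfolding tnn_on_def using minor_transpose by metis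

lemma tnn_on_compose:
  assumes "tnn_on R' C' A" "strict_mono_on R f" "strict_mono_on C g" "f ` R \<subseteq> R'" "g ` C \<subseteq> C'"
    and "\<And>i j. i \<in> R \<Longrightarrow> j \<in> C \<Longrightarrow> B i j = A (f i) (g j)"
  shows "tnn_on R C B"
proof (rule tnn_onI)
  fix k :: nat and r c assume rc: "strict_mono_on {..<k} r" "strict_mono_on {..<k} c"
    "r ` {..<k} \<subseteq> R" "c ` {..<k} \<subseteq> C"
  have "minor B k r c = minor A k (f \<circ> r) (g \<circ> c)"
    by (rule minor_cong) (use assms(6) rc in \<open>auto simp: image_subset_iff\<close>)
  also have "0 \<le> \<dots>"
  proof (rule tnn_onD[OF assms(1)])
    show "strict_mono_on {..<k} (f \<circ> r)"
      using rc(3) by (auto simp: image_subset_iff intro!: strict_mono_onI strict_mono_onD[OF assms(2)] strict_mono_onD[OF rc(1)])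
    show "strict_mono_on {..<k} (g \<circ> c)"
      using rc(4) by (auto simp: image_subset_iff intro!: strict_mono_onI strict_mono_onD[OF assms(3)] strict_mono_onD[OF rc(2)])
  qed (use assms(4,5) rc in \<open>auto simp: image_subset_iff\<close>)
  finally show "0 \<le> minor B k r c" .
qed

lemma tnn_on_nonneg:
  assumes "tnn_on R C A" "i \<in> R" "j \<in> C"
  shows "0 \<le> A i j"
proof -
  have "0 \<le> minor A 1 (\<lambda>_. i) (\<lambda>_. j)"
    by (rule tnn_onD[OF assms(1)]) (use assms in \<open>auto simp: strict_mono_on_def\<close>)
  then show ?thesis by (simp add: minor_def det_single)
qed

lemma det_2_by_2:
  assumes A: "A \<in> carrier_mat 2 2"
  shows "det A = A $$ (0, 0) * A $$ (1, 1) - A $$ (0, 1) * A $$ (1, 0)"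
proof -
  have "det A = (\<Sum>j<2. A $$ (0, j) * cofactor A 0 j)"
    by (rule laplace_expansion_row[OF A]) simp
  then show ?thesis
    using A by (simp add: numeral_2_eq_2 cofactor_def mat_delete_def det_single)
qed

lemma tnn_on_minor2:
  assumes "tnn_on R C A" "i \<in> R" "i' \<in> R" "i < i'" "j \<in> C" "j' \<in> C" "j < j'"
  shows "A i j' * A i' j \<le> A i j * A i' j'"
proof -
  have "0 \<le> minor A 2 (\<lambda>k. if k = 0 then i else i') (\<lambda>k. if k = 0 then j else j')"
    by (rule tnn_onD[OF assms(1)]) (use assms(2-) in \<open>auto simp: strict_mono_on_def\<close>)
  then show ?thesis by (simp add: minor_def det_2_by_2)
qed

section \<open>Vanishing minors and linearity in a row\<close>

lemma minor_row_zero: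
  assumes "i < k" "\<And>j. j < k \<Longrightarrow> A (r i) (c j) = 0"
  shows "minor A k r c = 0"
proof -
  let ?M = "mat k k (\<lambda>(i, j). A (r i) (c j))"
  have "det ?M = (\<Sum>j<k. ?M $$ (i, j) * cofactor ?M i j)"
    by (rule laplace_expansion_row) (use assms in auto)
  also have "\<dots> = 0"
    by (rule sum.neutral) (use assms in auto)
  finally show ?thesis by (simp add: minor_def)
qed

lemma minor_col_zero:
  assumes "j < k" "\<And>i. i < k \<Longrightarrow> A (r i) (c j) = 0"
  shows "minor A k r c = 0"
  using minor_row_zero[of j k "\<lambda>i j. A j i" c r] assms minor_transpose[of A k c r] by simp

lemma mat_delete_cong:
  assumes "A \<in> carrier_mat n n" "B \<in> carrier_mat n n"
    and "\<And>l m. l < n \<Longrightarrow> l \<noteq> i \<Longrightarrow> m < n \<Longrightarrow> A $$ (l, m) = B $$ (l, m)"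
  shows "mat_delete A i j = mat_delete B i j"
  unfolding mat_delete_def by (rule eq_matI) (use assms(1,2) in \<open>auto intro!: assms(3)\<close>)

text \<open>Laplace expansion along row \<open>i\<close>. The separate families and index functions
  allow a row to be changed either in the matrix or by selecting another index.\<close>

lemma minor_row_add:
  assumes i: "i < k"
    and row: "\<And>j. j < k \<Longrightarrow> A (r i) (c j) = B (r' i) (c j) + a * C (r'' i) (c j)"
    and B: "\<And>l j. l < k \<Longrightarrow> l \<noteq> i \<Longrightarrow> j < k \<Longrightarrow> A (r l) (c j) = B (r' l) (c j)"
    and C: "\<And>l j. l < k \<Longrightarrow> l \<noteq> i \<Longrightarrow> j < k \<Longrightarrow> A (r l) (c j) = C (r'' l) (c j)"
  shows "minor A k r c = minor B k r' c + a * minor C k r'' c"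
proof -
  let ?M = "mat k k (\<lambda>(i, j). A (r i) (c j))"
  let ?B = "mat k k (\<lambda>(i, j). B (r' i) (c j))"
  let ?C = "mat k k (\<lambda>(i, j). C (r'' i) (c j))"
  have "mat_delete ?B i j = mat_delete ?M i j" "mat_delete ?C i j = mat_delete ?M i j" if "j < k" for j
    by (rule mat_delete_cong[of _ k]; use B C in auto)+
  then have cof: "cofactor ?B i j = cofactor ?M i j" "cofactor ?C i j = cofactor ?M i j" if "j < k" for j
    using that by (simp_all add: cofactor_def)
  have "det ?B + a * det ?C = (\<Sum>j<k. ?B $$ (i, j) * cofactor ?M i j) + a * (\<Sum>j<k. ?C $$ (i, j) * cofactor ?M i j)"
    using laplace_expansion_row[of ?B k i] laplace_expansion_row[of ?C k i] i cof by simp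
  also have "\<dots> = (\<Sum>j<k. ?M $$ (i, j) * cofactor ?M i j)"
    unfolding sum_distrib_left sum.distrib[symmetric]
    by (rule sum.cong) (use i row in \<open>auto simp: algebra_simps\<close>)
  also have "\<dots> = det ?M"
    using laplace_expansion_row[of ?M k i] i by simp
  finally show ?thesis by (simp add: minor_def)
qed

lemma minor_identical_rows:
  assumes "i < k" "l < k" "i \<noteq> l" "\<And>j. j < k \<Longrightarrow> A (r i) (c j) = A (r l) (c j)"
  shows "minor A k r c = 0"
  unfolding minor_def
  by (rule det_identical_rows[of _ k i l]) (use assms in auto)

text \<open>The rows are treated from the largest index downwards, so that the row added at each
  stage is still an original one. By linearity the minor splits into an earlier minor and
  \<open>w m\<close> times a minor whose index \<open>m\<close> has become
  \<open>m - 1\<close>.\<close>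

lemma tnn_add_previous_rows:
  fixes A :: "int \<Rightarrow> 'b::linorder \<Rightarrow> real"
  assumes A: "tnn_on UNIV C A" and w: "\<And>i. 0 \<le> w i"
  shows "tnn_on UNIV C (\<lambda>i j. A i j + w i * A (i - 1) j)"
proof (rule tnn_onI)
  fix k and r :: "nat \<Rightarrow> int" and c
  assume rc: "strict_mono_on {..<k} r" "strict_mono_on {..<k} c" "c ` {..<k} \<subseteq> C"
  define A' where "A' m i j = A i j + (if i > m then w i * A (i - 1) j else 0)" for m i j
  \<comment> \<open>The inserted 0 keeps \<open>Max\<close> and \<open>Min\<close> meaningful for
    \<open>k = 0\<close>.\<close>
  define b where "b = Max (insert 0 (r ` {..<k}))"
  define a where "a = Min (insert 0 (r ` {..<k}))"
  have b: "r i \<le> b" and a: "a \<le> r i" if "i < k" for i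
    unfolding a_def b_def using that by auto
  \<comment> \<open>The index function varies in the induction, because the second minor of the
    splitting uses another one.\<close>
  have "0 \<le> minor (A' (b - int d)) k r c" if "strict_mono_on {..<k} r" "\<And>i. i < k \<Longrightarrow> r i \<le> b" for d r
    using that
  proof (induction d arbitrary: r)
    case 0
    have "minor (A' (b - int 0)) k r c = minor A k r c"
      by (rule minor_cong) (use 0 in \<open>fastforce simp: A'_def\<close>)
    then show ?case using tnn_onD[OF A 0(1) rc(2) _ rc(3)] by simp
  next
    case (Suc d)
    define m where "m = b - int d"
    have m': "b - int (Suc d) = m - 1" by (simp add: m_def)
    have step: "A' (m - 1) i j = A' m i j + (if i = m then w m * A' m (m - 1) j else 0)" for i j
      by (auto simp: A'_def)
    have IH: "0 \<le> minor (A' m) k r c" using Suc unfolding m_def by blast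
    show ?case
    proof (cases "m \<in> r ` {..<k}")
      case False
      then have "minor (A' (m - 1)) k r c = minor (A' m) k r c"
        by (intro minor_cong) (auto simp: step)
      then show ?thesis using IH unfolding m' by simp
    next
      case True
      then obtain i where i: "i < k" "r i = m" by auto
      have ne: "r l \<noteq> m" if "l < k" "l \<noteq> i" for l
        using strict_mono_on_eqD[OF Suc.prems(1), of l i] that i by auto
      let ?r = "r(i := m - 1)"
      have eq: "minor (A' (m - 1)) k r c = minor (A' m) k r c + w m * minor (A' m) k ?r c"
        by (rule minor_row_add[OF i(1)]) (use i ne in \<open>auto simp: step\<close>)
      \<comment> \<open>Since \<open>m - 1\<close> directly precedes \<open>m\<close>, the new index
        either repeats a selected row or keeps the selection strictly increasing.\<close>
      have "0 \<le> minor (A' m) k ?r c"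
      proof (cases "m - 1 \<in> r ` {..<k}")
        case True
        then obtain l where l: "l < k" "r l = m - 1" by auto
        then have "l \<noteq> i" using i by auto
        then have "minor (A' m) k ?r c = 0"
          by (intro minor_identical_rows[of l k i]) (use l i in auto)
        then show ?thesis by simp
      next
        case False
        have "strict_mono_on {..<k} ?r"
        proof (rule strict_mono_onI)
          fix x y assume xy: "x \<in> {..<k}" "y \<in> {..<k}" "x < y"
          then have "r x < r y" using Suc.prems(1) by (auto simp: strict_mono_on_def)
          moreover have "r x \<noteq> m - 1" "r y \<noteq> m - 1" using False xy by (metis imageI)+
          ultimately show "?r x < ?r y" using xy i by auto
        qed
        moreover have "?r l \<le> b" if "l < k" for l using Suc.prems(2) that by (auto simp: m_def)
        ultimately show ?thesis using Suc.IH unfolding m_def by blast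
      qed
      then show ?thesis using eq IH w unfolding m' by simp
    qed
  qed
  \<comment> \<open>After \<open>b - a + 1\<close> stages the threshold is \<open>a - 1\<close>,
    below every selected row.\<close>
  from this[of r "nat (b - a + 1)"] rc b have "0 \<le> minor (A' (b - int (nat (b - a + 1)))) k r c" by simp
  also have "minor (A' (b - int (nat (b - a + 1)))) k r c = minor (\<lambda>i j. A i j + w i * A (i - 1) j) k r c"
    by (rule minor_cong) (use a b in \<open>fastforce simp: A'_def\<close>)
  finally show "0 \<le> minor (\<lambda>i j. A i j + w i * A (i - 1) j) k r c" .
qed

lemma tnn_add_previous_columns:
  fixes A :: "'a::linorder \<Rightarrow> int \<Rightarrow> real"
  assumes "tnn_on R UNIV A" and "\<And>j. 0 \<le> w j"
  shows "tnn_on R UNIV (\<lambda>i j. A i j + w j * A i (j - 1))"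
proof -
  have "tnn_on UNIV R (\<lambda>j i. A i j)"
    using assms(1) by (rule tnn_on_transpose[THEN iffD2])
  then have "tnn_on UNIV R (\<lambda>j i. A i j + w j * A i (j - 1))"
    using assms(2) by (rule tnn_add_previous_rows)
  then show ?thesis
    by (rule tnn_on_transpose[THEN iffD1])
qed

text \<open>Block elimination with a 1 by 1 pivot: the matrix is a unit lower triangular one times a
  block upper triangular one, whose diagonal blocks are the pivot and its Schur complement.\<close>

lemma minor_Suc_schur:
  assumes b: "A (r 0) (c 0) \<noteq> 0"
    and S: "\<And>i j. i < k \<Longrightarrow> j < k \<Longrightarrow>
      S (r' i) (c' j) = A (r (Suc i)) (c (Suc j)) - A (r (Suc i)) (c 0) * A (r 0) (c (Suc j)) / A (r 0) (c 0)"
  shows "minor A (Suc k) r c = A (r 0) (c 0) * minor S k r' c'"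
proof -
  let ?b = "A (r 0) (c 0)"
  let ?M = "mat (Suc k) (Suc k) (\<lambda>(i, j). A (r i) (c j))"
  let ?S = "mat k k (\<lambda>(i, j). S (r' i) (c' j))"
  let ?x = "mat k 1 (\<lambda>(i, j). A (r (Suc i)) (c 0) / ?b)"
  let ?y = "mat 1 k (\<lambda>(i, j). A (r 0) (c (Suc j)))"
  let ?b1 = "mat 1 1 (\<lambda>_. ?b)"
  let ?L = "four_block_mat (1\<^sub>m 1) (0\<^sub>m 1 k) ?x (1\<^sub>m k)"
  let ?U = "four_block_mat ?b1 ?y (0\<^sub>m k 1) ?S"
  have "?L * ?U = four_block_mat (1\<^sub>m 1 * ?b1 + 0\<^sub>m 1 k * 0\<^sub>m k 1) (1\<^sub>m 1 * ?y + 0\<^sub>m 1 k * ?S)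
    (?x * ?b1 + 1\<^sub>m k * 0\<^sub>m k 1) (?x * ?y + 1\<^sub>m k * ?S)"
    by (rule mult_four_block_mat[of _ 1 1 _ k _ k]) auto
  also have "\<dots> = ?M"
    by (rule eq_matI) (use b in \<open>auto simp: scalar_prod_def less_Suc_eq_0_disj S\<close>)
  finally have "det ?M = det ?L * det ?U"
    by (metis det_mult four_block_carrier_mat one_carrier_mat mat_carrier)
  also have "det ?L = 1"
    by (subst det_four_block_mat_upper_right_zero[of _ 1 _ k]) auto
  also have "det ?U = ?b * det ?S"
    by (subst det_four_block_mat_lower_left_zero[of _ 1 _ k]) (auto simp: det_single)
  finally show ?thesis by (simp add: minor_def)
qed

text \<open>A minor of the Schur complement, times the pivot, is the minor of \<open>B\<close>
  bordered by row 0 and column 0.\<close>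

lemma tnn_on_schur_complement:
  fixes B :: "nat \<Rightarrow> nat \<Rightarrow> real"
  assumes B: "tnn_on {..<Suc N} {..<Suc N} B" and pos: "0 < B 0 0"
  shows "tnn_on {..<N} {..<N} (\<lambda>i j. B (Suc i) (Suc j) - B (Suc i) 0 * B 0 (Suc j) / B 0 0)"
    (is "tnn_on _ _ ?S")
proof (rule tnn_onI)
  fix k and r c :: "nat \<Rightarrow> nat"
  assume rc: "strict_mono_on {..<k} r" "strict_mono_on {..<k} c" "r ` {..<k} \<subseteq> {..<N}" "c ` {..<k} \<subseteq> {..<N}"
  have up: "strict_mono_on {..<Suc k} (case_nat 0 (\<lambda>i. Suc (f i)))" if "strict_mono_on {..<k} f" for f
    using that by (auto simp: strict_mono_on_def less_Suc_eq_0_disj)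
  let ?r = "case_nat 0 (\<lambda>i. Suc (r i))" and ?c = "case_nat 0 (\<lambda>i. Suc (c i))"
  have "minor B (Suc k) ?r ?c = B 0 0 * minor ?S k r c"
    using minor_Suc_schur[of B ?r ?c k ?S r c] pos by simp
  moreover have "0 \<le> minor B (Suc k) ?r ?c"
  proof (rule tnn_onD[OF B])
    show "?r ` {..<Suc k} \<subseteq> {..<Suc N}" "?c ` {..<Suc k} \<subseteq> {..<Suc N}"
      using rc(3,4) by (auto simp: less_Suc_eq_0_disj image_subset_iff)
  qed (use up rc in auto)
  ultimately show "0 \<le> minor ?S k r c" using pos by (simp add: zero_le_mult_iff)
qed

section \<open>Increasing index functions versus index sets\<close>

lemma pick_image_strict_mono:
  assumes "strict_mono_on {..<k} r" "i < k"
  shows "pick (r ` {..<k}) i = r i"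
proof -
  have "r l < r i \<longleftrightarrow> l < i" if "l < k" for l
    using strict_mono_on_less[OF assms(1), of l i] assms(2) that by auto
  then have "{a \<in> r ` {..<k}. a < r i} = r ` {..<i}"
    using assms(2) by auto
  moreover have "inj_on r {..<i}"
    using assms strict_mono_on_imp_inj_on[OF assms(1)] by (auto elim: inj_on_subset)
  ultimately have "card {a \<in> r ` {..<k}. a < r i} = i" by (simp add: card_image)
  then show ?thesis using pick_card_in_set[of "r i" "r ` {..<k}"] assms by auto
qed

lemma totally_nonnegative_iff_tnn_on:
  "totally_nonnegative A \<longleftrightarrow> tnn_on {..<dim_row A} {..<dim_col A} (\<lambda>i j. A $$ (i, j))"
proof
  assume A: "totally_nonnegative A"
  show "tnn_on {..<dim_row A} {..<dim_col A} (\<lambda>i j. A $$ (i, j))"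
  proof (rule tnn_onI)
    fix k :: nat and r c assume rc: "strict_mono_on {..<k} r" "strict_mono_on {..<k} c"
      "r ` {..<k} \<subseteq> {..<dim_row A}" "c ` {..<k} \<subseteq> {..<dim_col A}"
    have card: "card (r ` {..<k}) = k" "card (c ` {..<k}) = k"
      using rc by (simp_all add: card_image strict_mono_on_imp_inj_on)
    have sets: "{i. i < dim_row A \<and> i \<in> r ` {..<k}} = r ` {..<k}"
      "{j. j < dim_col A \<and> j \<in> c ` {..<k}} = c ` {..<k}"
      using rc by auto
    have "submatrix A (r ` {..<k}) (c ` {..<k}) = mat k k (\<lambda>(i, j). A $$ (r i, c j))"
      unfolding submatrix_def sets card
      by (rule eq_matI) (use rc in \<open>auto simp: pick_image_strict_mono\<close>)
    then show "0 \<le> minor (\<lambda>i j. A $$ (i, j)) k r c"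
      using A rc card unfolding totally_nonnegative_def minor_def by metis
  qed
next
  assume A: "tnn_on {..<dim_row A} {..<dim_col A} (\<lambda>i j. A $$ (i, j))"
  show "totally_nonnegative A"
    unfolding totally_nonnegative_def
  proof (intro allI impI)
    fix I J assume IJ: "I \<subseteq> {..<dim_row A} \<and> J \<subseteq> {..<dim_col A} \<and> card I = card J"
    then have sets: "{i. i < dim_row A \<and> i \<in> I} = I" "{j. j < dim_col A \<and> j \<in> J} = J" by auto
    have mono: "strict_mono_on {..<card K} (pick K)" "pick K ` {..<card K} \<subseteq> K" for K
      by (auto simp: strict_mono_on_def pick_mono_le pick_in_set_le)
    have "0 \<le> minor (\<lambda>i j. A $$ (i, j)) (card I) (pick I) (pick J)"
      by (rule tnn_onD[OF A]) (use IJ mono[of I] mono[of J] in auto)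
    then show "0 \<le> det (submatrix A I J)"
      unfolding submatrix_def sets minor_def using IJ by simp
  qed
qed

subsection \<open>Continued fractions and interlaced Toeplitz matrices\<close>

definition icoeff :: "real poly \<Rightarrow> int \<Rightarrow> real" where
  "icoeff p k = (if k < 0 then 0 else poly.coeff p (nat k))"

text \<open>Rows and columns run over all integers, so that undoing a division step is a renumbering
  of rows followed by row additions, without boundary cases.\<close>

definition interlaced :: "real poly \<Rightarrow> real poly \<Rightarrow> int \<Rightarrow> int \<Rightarrow> real" where
  "interlaced u v r s = icoeff (if even r then u else v) (s - r div 2)"

lemma icoeff_simps [simp]:
  "icoeff 0 k = 0"
  "icoeff (p + q) k = icoeff p k + icoeff q k"
  "icoeff (smult c p) k = c * icoeff p k"
  "icoeff (pCons 0 p) k = icoeff p (k - 1)"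
  by (auto simp: icoeff_def coeff_pCons nat_diff_distrib split: nat.split)

text \<open>
  The Stieltjes continued fraction of \<open>v / u\<close> with positive partial quotients, where
  \<open>e\<close> plays the role of the greatest common divisor.
\<close>

inductive stieltjes_chain :: "real poly \<Rightarrow> real poly \<Rightarrow> real poly \<Rightarrow> bool" for e where
  base: "stieltjes_chain e 0 e"
| step: "stieltjes_chain e u' u \<Longrightarrow> 0 < c \<Longrightarrow> stieltjes_chain e u (smult c u + pCons 0 u')"

text \<open>
  The doubly infinite matrix of \<open>(u, t u')\<close> is that of \<open>(u', u)\<close> with its rows renumbered.
\<close>

lemma tnn_interlaced_step:
  assumes "tnn_on UNIV UNIV (interlaced u' u)" and "0 \<le> c"
  shows "tnn_on UNIV UNIV (interlaced u (smult c u + pCons 0 u'))"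
proof -
  have "tnn_on UNIV UNIV (interlaced u (pCons 0 u'))"
  proof (rule tnn_on_compose[OF assms(1)])
    fix r s :: int
    show "interlaced u (pCons 0 u') r s = interlaced u' u (r + 1) s"
      by (cases "even r") (auto simp: interlaced_def algebra_simps elim!: evenE oddE)
  qed (auto simp: strict_mono_on_def intro: monoI)
  \<comment> \<open>Each odd row receives \<open>c\<close> times the row before it, which turns
    \<open>t u'\<close> into \<open>c u + t u'\<close>.\<close>
  from tnn_add_previous_rows[OF this, of "\<lambda>r. if odd r then c else 0"]
  have "tnn_on UNIV UNIV (\<lambda>r s. interlaced u (pCons 0 u') r s +
      (if odd r then c else 0) * interlaced u (pCons 0 u') (r - 1) s)"
    using assms(2) by simp
  also have "(\<lambda>r s. interlaced u (pCons 0 u') r s +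
      (if odd r then c else 0) * interlaced u (pCons 0 u') (r - 1) s) =
      interlaced u (smult c u + pCons 0 u')"
    by (auto simp: fun_eq_iff interlaced_def elim!: oddE)
  finally show ?thesis .
qed

text \<open>Even rows vanish, and row \<open>2 i + 1\<close> has the single entry \<open>a\<close>
  in column \<open>i\<close>. Hence a minor of odd rows is diagonal, or the first mismatch of rows
  and columns produces a zero row or column.\<close>

lemma tnn_interlaced_const:
  assumes "0 \<le> a"
  shows "tnn_on UNIV UNIV (interlaced 0 [:a:])"
proof (rule tnn_onI)
  fix k and r c :: "nat \<Rightarrow> int"
  assume rc: "strict_mono_on {..<k} r" "strict_mono_on {..<k} c"
  let ?A = "interlaced 0 [:a:]"
  have entry: "?A i j = (if odd i \<and> j = i div 2 then a else 0)" for i j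
    by (auto simp: interlaced_def icoeff_def coeff_pCons split: nat.split)
  have c_less: "c i < c j \<longleftrightarrow> i < j" if "i < k" "j < k" for i j
    using strict_mono_on_less[OF rc(2)] that by simp
  show "0 \<le> minor ?A k r c"
  proof (cases "\<exists>i<k. even (r i)")
    case True
    then obtain i where "i < k" "even (r i)" by auto
    then have "minor ?A k r c = 0" by (intro minor_row_zero[of i]) (auto simp: entry)
    then show ?thesis by simp
  next
    case all_odd: False
    define \<rho> where "\<rho> i = r i div 2" for i
    have \<rho>_less: "\<rho> i < \<rho> j" if "i < j" "j < k" for i j
    proof -
      have "r i < r j" "odd (r i)" "odd (r j)"
        using strict_mono_onD[OF rc(1)] that all_odd by auto
      then show ?thesis unfolding \<rho>_def by presburger
    qed
    show ?thesis
    proof (cases "\<exists>i<k. \<rho> i \<noteq> c i")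
      case False
      have "minor ?A k r c = minor (\<lambda>i j. if i = j then a else 0) k id id"
      proof (rule minor_cong)
        fix i j assume ij: "i < k" "j < k"
        have "odd (r i)" "r i div 2 = c i"
          using all_odd False ij by (auto simp: \<rho>_def)
        moreover have "c j = c i \<longleftrightarrow> i = j"
          using c_less[of i j] c_less[of j i] ij by (metis less_irrefl linorder_neqE_nat)
        ultimately show "?A (r i) (c j) = (if id i = id j then a else 0)"
          by (simp add: entry)
      qed
      also have "\<dots> = a ^ k"
      proof -
        let ?M = "mat k k (\<lambda>(i, j). if id i = id j then a else 0)"
        have "diag_mat ?M = replicate k a"
          by (rule nth_equalityI) (auto simp: diag_mat_def)
        moreover have "det ?M = prod_list (diag_mat ?M)"
          by (rule det_upper_triangular) auto
        ultimately show ?thesis by (simp add: minor_def)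
      qed
      finally show ?thesis using assms by simp
    next
      case True
      \<comment> \<open>Before \<open>m\<close> rows and columns are paired with each other. As both
        sequences increase, the smaller of \<open>\<rho> m\<close> and \<open>c m\<close> has no
        partner left.\<close>
      define m where "m = (LEAST i. i < k \<and> \<rho> i \<noteq> c i)"
      have m: "m < k" "\<rho> m \<noteq> c m"
        using LeastI_ex[of "\<lambda>i. i < k \<and> \<rho> i \<noteq> c i"] True by (auto simp: m_def)
      have below: "\<rho> i = c i" if "i < m" for i
        using not_less_Least[of i "\<lambda>i. i < k \<and> \<rho> i \<noteq> c i"] that m by (auto simp: m_def)
      have "minor ?A k r c = 0"
      proof (cases "\<rho> m < c m")
        case True
        have "c j \<noteq> \<rho> m" if "j < k" for j
          using below[of j] \<rho>_less[of j m] c_less[of m j] m that True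
          by (cases m j rule: linorder_cases) auto
        then show ?thesis
          by (intro minor_row_zero[of m]) (use m in \<open>auto simp: entry \<rho>_def\<close>)
      next
        case False
        have "c m \<noteq> \<rho> i" if "i < k" for i
          using below[of i] \<rho>_less[of m i] c_less[of i m] m that False
          by (cases m i rule: linorder_cases) auto
        then show ?thesis
          by (intro minor_col_zero[of m]) (use m in \<open>auto simp: entry \<rho>_def\<close>)
      qed
      then show ?thesis by simp
    qed
  qed
qed

text \<open>Multiplication by \<open>1 + y t\<close> adds \<open>y\<close> times the preceding
  column to every column.\<close>

lemma tnn_interlaced_product:
  assumes "0 \<le> a" "\<And>y. y \<in> set ys \<Longrightarrow> 0 \<le> y"
  shows "tnn_on UNIV UNIV (interlaced 0 (smult a (\<Prod>y\<leftarrow>ys. [:1, y:])))"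
  using assms(2)
proof (induction ys)
  case Nil
  then show ?case using tnn_interlaced_const[OF assms(1)] by simp
next
  case (Cons y ys)
  let ?q = "smult a (\<Prod>y\<leftarrow>ys. [:1, y:])"
  have q: "smult a (\<Prod>y\<leftarrow>y # ys. [:1, y:]) = ?q + smult y (pCons 0 ?q)"
    by (simp add: mult_pCons_left smult_add_right mult.commute)
  have "tnn_on UNIV UNIV (\<lambda>r s. interlaced 0 ?q r s + y * interlaced 0 ?q r (s - 1))"
    by (rule tnn_add_previous_columns) (use Cons in auto)
  also have "(\<lambda>r s. interlaced 0 ?q r s + y * interlaced 0 ?q r (s - 1)) =
      interlaced 0 (?q + smult y (pCons 0 ?q))"
    by (auto simp: fun_eq_iff interlaced_def algebra_simps simp del: smult_pCons smult_smult)
  finally show ?case unfolding q .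
qed

lemma stieltjes_chain_tnn:
  assumes "stieltjes_chain e u v" and "tnn_on UNIV UNIV (interlaced 0 e)"
  shows "tnn_on UNIV UNIV (interlaced u v)"
  using assms by induction (auto intro: tnn_interlaced_step)

lemma stieltjes_chain_dvd:
  assumes "stieltjes_chain e u v"
  shows "e dvd u \<and> e dvd v"
  using assms
proof induction
  case (step u' u c)
  have "pCons 0 u' = [:0, 1:] * u'" by simp
  then show ?case using step by (metis dvd_add dvd_mult dvd_smult)
qed simp

section \<open>Evaluation at complex points and the upper half plane\<close>

abbreviation cpoly :: "real poly \<Rightarrow> complex poly" where
  "cpoly \<equiv> map_poly complex_of_real"

lemma poly_cpoly_simps [simp]:
  "poly (cpoly (p + q)) z = poly (cpoly p) z + poly (cpoly q) z"
  "poly (cpoly (p * q)) z = poly (cpoly p) z * poly (cpoly q) z"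
  "poly (cpoly (smult c p)) z = of_real c * poly (cpoly p) z"
  "poly (cpoly (pCons a p)) z = of_real a + z * poly (cpoly p) z"
  "poly (cpoly 1) z = 1"
proof -
  show add: "poly (cpoly (p + q)) z = poly (cpoly p) z + poly (cpoly q) z" for p q
  proof -
    have "cpoly (p + q) = cpoly p + cpoly q" by (rule poly_eqI) (simp add: coeff_map_poly)
    then show ?thesis by simp
  qed
  show smult: "poly (cpoly (smult c p)) z = of_real c * poly (cpoly p) z" for c p
  proof -
    have "cpoly (smult c p) = smult (of_real c) (cpoly p)" by (rule poly_eqI) (simp add: coeff_map_poly)
    then show ?thesis by simp
  qed
  show pCons: "poly (cpoly (pCons a p)) z = of_real a + z * poly (cpoly p) z" for a p
    by (simp add: map_poly_pCons)
  show "poly (cpoly (p * q)) z = poly (cpoly p) z * poly (cpoly q) z"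
    by (induction p) (simp_all add: add smult pCons algebra_simps)
  show "poly (cpoly 1) z = 1"
    by simp
qed

text \<open>With \<open>w = a / b\<close>, a step replaces \<open>w\<close> by
  \<open>1 / (c + t w)\<close>, starting from \<open>w = 0\<close>. Since
  \<open>t / (c + t w) = 1 / (c / t + w)\<close> and \<open>c / t\<close> lies in the lower half
  plane, inversion exchanges the two sign conditions.\<close>

lemma stieltjes_chain_nevanlinna:
  assumes "stieltjes_chain e u v"
  shows "\<exists>a b. u = e * a \<and> v = e * b \<and>
    (\<forall>t. 0 < Im t \<longrightarrow> poly (cpoly b) t \<noteq> 0 \<and>
       Im (poly (cpoly a) t / poly (cpoly b) t) \<le> 0 \<and>
       0 \<le> Im (t * (poly (cpoly a) t / poly (cpoly b) t)))"
  using assms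
proof induction
  case base
  show ?case by (intro exI[of _ 0] exI[of _ 1]) auto
next
  case (step u' u c)
  then obtain a b where ab: "u' = e * a" "u = e * b"
    and S: "\<And>t. 0 < Im t \<Longrightarrow> poly (cpoly b) t \<noteq> 0"
      "\<And>t. 0 < Im t \<Longrightarrow> Im (poly (cpoly a) t / poly (cpoly b) t) \<le> 0"
      "\<And>t. 0 < Im t \<Longrightarrow> 0 \<le> Im (t * (poly (cpoly a) t / poly (cpoly b) t))"
    by blast
  let ?d = "smult c b + pCons 0 a"
  show ?case
  proof (rule exI[of _ b], rule exI[of _ ?d], intro conjI allI impI)
    show "u = e * b" by (rule ab)
    show "smult c u + pCons 0 u' = e * ?d"
      by (simp add: ab algebra_simps)
    fix t :: complex assume t: "0 < Im t"
    define w where "w = poly (cpoly a) t / poly (cpoly b) t"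
    have b0: "poly (cpoly b) t \<noteq> 0" and w: "Im w \<le> 0" "0 \<le> Im (t * w)"
      using S t by (auto simp: w_def)
    have t0: "t \<noteq> 0" using t by auto
    have d: "poly (cpoly ?d) t = poly (cpoly b) t * (of_real c + t * w)"
      using b0 by (simp add: w_def field_simps)
    have im_ct: "Im (of_real c / t) < 0"
      using t step(2) by (simp add: Im_divide divide_neg_pos add_nonneg_pos)
    \<comment> \<open>A zero would mean \<open>w = - c / t\<close>, which lies in the open upper
      half plane.\<close>
    have ne: "of_real c + t * w \<noteq> 0"
    proof
      assume "of_real c + t * w = 0"
      then have "w = - (of_real c / t)" using t0 by (simp add: field_simps add_eq_0_iff)
      then show False using im_ct w(1) by simp
    qed
    then show "poly (cpoly ?d) t \<noteq> 0" using d b0 by simp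
    have inv: "Im (1 / z) \<le> 0 \<longleftrightarrow> 0 \<le> Im z" "0 \<le> Im (1 / z) \<longleftrightarrow> Im z \<le> 0" for z
      by (auto simp: Im_divide divide_le_0_iff zero_le_divide_iff sum_power2_le_zero_iff
          complex_eq_iff add_nonneg_eq_0_iff not_le)
    have q: "poly (cpoly b) t / poly (cpoly ?d) t = 1 / (of_real c + t * w)"
      unfolding d using b0 ne by (simp add: divide_simps)
    show "Im (poly (cpoly b) t / poly (cpoly ?d) t) \<le> 0"
      unfolding q inv using w(2) by simp
    have tq: "t * (1 / (of_real c + t * w)) = 1 / (of_real c / t + w)"
      using t0 ne by (simp add: field_simps)
    show "0 \<le> Im (t * (poly (cpoly b) t / poly (cpoly ?d) t))"
      unfolding q tq inv using w(1) im_ct by simp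
  qed
qed

subsection \<open>Orthogonal remainders of a product of linear factors\<close>

lemma smult_sum_right: "smult c (\<Sum>i\<in>A. f i) = (\<Sum>i\<in>A. smult c (f i))"
  by (rule poly_eqI) (simp add: coeff_sum sum_distrib_left)

lemma pCons_0_sum: "pCons 0 (\<Sum>i\<in>A. f i) = (\<Sum>i\<in>A. pCons 0 (f i))"
  by (rule poly_eqI) (simp add: coeff_sum coeff_pCons split: nat.split)

text \<open>The value \<open>x j = 0\<close> is allowed: such factors 1 pad the product when the
  reversed polynomial has degree below \<open>n\<close>.\<close>

locale nonneg_reciprocal_roots =
  fixes n :: nat and x :: "nat \<Rightarrow> real" and a :: real
  assumes x_nonneg: "j < n \<Longrightarrow> 0 \<le> x j" and a_pos: "0 < a"
begin

definition v :: "real poly" where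
  "v = smult a (\<Prod>i<n. [:1, x i:])"

text \<open>For \<open>j < n\<close> this is \<open>v / (1 + x j t)\<close>, written without
  division.\<close>

definition P :: "nat \<Rightarrow> real poly" where
  "P j = smult a (\<Prod>i\<in>{..<n} - {j}. [:1, x i:])"

text \<open>The numerator of the sum of \<open>h j / (1 + x j t)\<close> over the common denominator
  \<open>v\<close>.\<close>

definition U :: "(nat \<Rightarrow> real) \<Rightarrow> real poly" where
  "U h = (\<Sum>j<n. smult (h j) (P j))"

definition y :: "nat \<Rightarrow> real" where
  "y j = sqrt (x j)"

definition L :: "nat \<Rightarrow> (nat \<Rightarrow> real) \<Rightarrow> real" where
  "L k h = (\<Sum>j<n. y j ^ k * h j)"

lemma v_eq_P: "j < n \<Longrightarrow> v = P j + smult (x j) (pCons 0 (P j))"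
  unfolding v_def P_def by (subst prod.remove[of _ j]) (auto simp: algebra_simps smult_add_right)

lemma coeff_P_0: "coeff (P j) 0 = a"
  by (simp add: P_def coeff_0_prod_list poly_0_coeff_0[symmetric] poly_prod)

lemma coeff_U_0: "coeff (U h) 0 = a * L 0 h"
  by (simp add: U_def L_def coeff_sum coeff_P_0 sum_distrib_left mult.commute)

lemma L_diff: "L k (\<lambda>j. f j - g j) = L k f - L k g"
  and L_scale: "L k (\<lambda>j. c * f j) = c * L k f"
  and L_y: "L k (\<lambda>j. y j * f j) = L (Suc k) f"
  and L_y_power: "L k (\<lambda>j. y j ^ i * f j) = L (i + k) f"
  by (simp_all add: L_def algebra_simps sum.distrib sum_subtractf sum_distrib_left power_add)

lemma U_diff: "U (\<lambda>j. f j - g j) = U f - U g"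
  and U_scale: "U (\<lambda>j. c * f j) = smult c (U f)"
  by (simp_all add: U_def smult_diff_left sum_subtractf smult_sum_right)

text \<open>The quotient \<open>t v' / v\<close> is the sum of the terms
  \<open>1 - 1 / (1 + x j t)\<close>.\<close>

lemma log_deriv: "smult (real n) v - pCons 0 (pderiv v) = U (\<lambda>_. 1)"
proof -
  have "pderiv v = (\<Sum>j<n. smult (x j) (P j))"
    by (simp add: v_def P_def pderiv_smult pderiv_prod smult_sum_right pderiv_pCons mult.commute)
  then have "pCons 0 (pderiv v) = (\<Sum>j<n. smult (x j) (pCons 0 (P j)))"
    by (simp add: pCons_0_sum)
  also have "\<dots> = (\<Sum>j<n. v - P j)"
    by (rule sum.cong) (use v_eq_P in \<open>auto simp: algebra_simps\<close>)
  finally show ?thesis by (simp add: U_def sum_subtractf of_nat_poly)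
qed

text \<open>Termwise \<open>1 / (1 + x t) = 1 - x t / (1 + x t)\<close>. When
  \<open>L 0 h = 0\<close>, this divides \<open>U h\<close> by \<open>t\<close>.\<close>

lemma U_shift: "U h = smult (L 0 h) v - pCons 0 (U (\<lambda>j. x j * h j))"
proof -
  have "U h = (\<Sum>j<n. smult (h j) v - pCons 0 (smult (x j * h j) (P j)))"
    unfolding U_def by (rule sum.cong) (use v_eq_P in \<open>auto simp: algebra_simps smult_add_right\<close>)
  then show ?thesis
    by (simp add: U_def L_def sum_subtractf smult_sum pCons_0_sum)
qed

text \<open>On the symmetric points \<open>y j\<close> and \<open>- y j\<close>, a function of the
  parity of \<open>k\<close> is automatically orthogonal to the powers of the other parity.\<close>

definition orth :: "nat \<Rightarrow> (nat \<Rightarrow> real) \<Rightarrow> bool" where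
  "orth k h \<longleftrightarrow> (\<forall>s<k. even (k + s) \<longrightarrow> L s h = 0)"

text \<open>
  \<open>orth_fun k R\<close> stands for a polynomial of degree \<open>k\<close> in \<open>y\<close> of the parity of \<open>k\<close>, with
  positive leading coefficient \<open>l\<close> and orthogonal to the lower powers of the same parity:
  instead of its coefficients, only the effect \<open>R \<equiv> l y\<^sup>k\<close> modulo lower powers on
  vectors orthogonal to these is recorded. Taking \<open>h = R\<close> yields \<open>l L k R = \<Sum>j<n. (R j)\<^sup>2\<close>.
\<close>

definition orth_fun :: "nat \<Rightarrow> (nat \<Rightarrow> real) \<Rightarrow> bool" where
  "orth_fun k R \<longleftrightarrow> orth k R \<and>
     (\<exists>l>0. \<forall>h. orth k h \<longrightarrow> L 0 (\<lambda>j. R j * h j) = l * L k h)"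

lemma orth_fun_nonneg:
  assumes "orth_fun k R"
  shows "0 \<le> L k R" and "L k R = 0 \<Longrightarrow> j < n \<Longrightarrow> R j = 0"
proof -
  obtain l where l: "0 < l" "L 0 (\<lambda>j. R j * R j) = l * L k R"
    using assms by (auto simp: orth_fun_def)
  moreover have "0 \<le> L 0 (\<lambda>j. R j * R j)" by (simp add: L_def sum_nonneg)
  ultimately show "0 \<le> L k R" by (simp add: zero_le_mult_iff)
  show "R j = 0" if "L k R = 0" "j < n"
    using l that by (simp add: L_def sum_nonneg_eq_0_iff)
qed

text \<open>The three-term recurrence of orthogonal polynomials. The choice of \<open>c\<close>
  makes the moment of order \<open>m\<close> vanish; the lower ones vanish for \<open>y R'\<close>
  and \<open>R\<close> separately.\<close>

lemma orth_fun_step: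
  assumes R: "orth_fun m R" and R': "orth_fun (Suc m) R'"
    and c: "0 < c" "c * L (Suc m) R' = L m R"
  shows "orth_fun (Suc (Suc m)) (\<lambda>j. c * (y j * R' j) - R j)" (is "orth_fun _ ?Q")
  unfolding orth_fun_def
proof
  have LQ: "L s ?Q = c * L (Suc s) R' - L s R" for s
    by (simp add: L_diff L_scale L_y)
  show "orth (Suc (Suc m)) ?Q"
    unfolding orth_def
  proof (intro allI impI)
    fix s assume s: "s < Suc (Suc m)" "even (Suc (Suc m) + s)"
    then have "s = m \<or> s < m" by (auto elim: less_SucE)
    then show "L s ?Q = 0"
    proof
      assume "s < m"
      then show ?thesis using R R' s unfolding LQ by (auto simp: orth_fun_def orth_def)
    qed (use c in \<open>simp add: LQ\<close>)
  qed
  obtain l l' where l: "0 < l" "0 < l'"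
      "\<And>h. orth m h \<Longrightarrow> L 0 (\<lambda>j. R j * h j) = l * L m h"
      "\<And>h. orth (Suc m) h \<Longrightarrow> L 0 (\<lambda>j. R' j * h j) = l' * L (Suc m) h"
    using R R' by (auto simp: orth_fun_def)
  show "\<exists>l>0. \<forall>h. orth (Suc (Suc m)) h \<longrightarrow> L 0 (\<lambda>j. ?Q j * h j) = l * L (Suc (Suc m)) h"
  proof (intro exI[of _ "c * l'"] conjI allI impI)
    show "0 < c * l'" using c l by simp
    fix h assume h: "orth (Suc (Suc m)) h"
    have "orth m h" "orth (Suc m) (\<lambda>j. y j * h j)" "L m h = 0"
      using h by (auto simp: orth_def L_y)
    note l(3)[OF this(1)] l(4)[OF this(2)] this(3)
    moreover have "L 0 (\<lambda>j. ?Q j * h j) = c * L 0 (\<lambda>j. R' j * (y j * h j)) - L 0 (\<lambda>j. R j * h j)"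
      unfolding L_scale[symmetric] L_diff[symmetric] by (simp add: algebra_simps)
    ultimately show "L 0 (\<lambda>j. ?Q j * h j) = c * l' * L (Suc (Suc m)) h"
      by (simp add: L_y)
  qed
qed

lemma stieltjes_chain_orth_fun:
  assumes "orth_fun m R" "orth_fun (Suc m) R'" "0 < L m R"
    and "\<And>i. N \<le> 2 * i + 1 \<Longrightarrow> coeff (U (\<lambda>j. y j ^ Suc m * R' j)) i = 0"
    and "\<And>i. N \<le> 2 * i \<Longrightarrow> coeff (U (\<lambda>j. y j ^ m * R j)) i = 0"
  shows "\<exists>e. 0 < coeff e 0 \<and>
    stieltjes_chain e (U (\<lambda>j. y j ^ Suc m * R' j)) (U (\<lambda>j. y j ^ m * R j))"
  using assms
proof (induction N arbitrary: m R R')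
  case 0
  then have "U (\<lambda>j. y j ^ m * R j) = 0" by (intro poly_eqI) auto
  then show ?case using coeff_U_0[of "\<lambda>j. y j ^ m * R j"] 0 a_pos by (simp add: L_y_power)
next
  case (Suc N)
  let ?u' = "U (\<lambda>j. y j ^ Suc m * R' j)" and ?u = "U (\<lambda>j. y j ^ m * R j)"
  show ?case
  proof (cases "L (Suc m) R' = 0")
    case True
    then have "?u' = 0"
      using orth_fun_nonneg(2)[OF Suc.prems(2)] by (simp add: U_def)
    moreover have "0 < coeff ?u 0"
      using Suc.prems(3) a_pos by (simp add: coeff_U_0 L_y_power)
    ultimately show ?thesis using stieltjes_chain.base[of ?u] by metis
  next
    case False
    then have pos: "0 < L (Suc m) R'"
      using orth_fun_nonneg(1)[OF Suc.prems(2)] by simp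
    define c where "c = L m R / L (Suc m) R'"
    have c: "0 < c" "c * L (Suc m) R' = L m R"
      using pos Suc.prems(3) by (simp_all add: c_def)
    let ?Q = "\<lambda>j. c * (y j * R' j) - R j"
    let ?u'' = "U (\<lambda>j. y j ^ Suc (Suc m) * ?Q j)"
    have y2: "j < n \<Longrightarrow> x j = y j * y j" for j
      by (simp add: y_def x_nonneg)
    have "L 0 (\<lambda>j. y j ^ m * R j - c * (y j ^ Suc m * R' j)) = 0"
      unfolding L_diff L_scale L_y_power using c by simp
    then have "U (\<lambda>j. y j ^ m * R j - c * (y j ^ Suc m * R' j)) =
        - pCons 0 (U (\<lambda>j. x j * (y j ^ m * R j - c * (y j ^ Suc m * R' j))))"
      by (subst U_shift) simp
    also have "\<dots> = pCons 0 (- U (\<lambda>j. x j * (y j ^ m * R j - c * (y j ^ Suc m * R' j))))"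
      by (rule poly_eqI) (simp add: coeff_pCons split: nat.split)
    also have "- U (\<lambda>j. x j * (y j ^ m * R j - c * (y j ^ Suc m * R' j))) = ?u''"
      unfolding U_def sum_negf[symmetric]
      by (rule sum.cong) (auto simp: y2 algebra_simps simp flip: smult_minus_left)
    finally have u: "?u = smult c ?u' + pCons 0 ?u''"
      by (simp add: U_diff U_scale algebra_simps)
    have "\<exists>e. 0 < coeff e 0 \<and> stieltjes_chain e ?u'' ?u'"
    proof (rule Suc.IH)
      show "orth_fun (Suc m) R'" "0 < L (Suc m) R'" by fact+
      show "orth_fun (Suc (Suc m)) ?Q" by (rule orth_fun_step) (use Suc.prems c in auto)
      show "coeff ?u' i = 0" if "N \<le> 2 * i" for i using Suc.prems(4) that by simp
      show "coeff ?u'' i = 0" if "N \<le> 2 * i + 1" for i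
        using arg_cong[OF u, of "\<lambda>p. coeff p (Suc i)"] Suc.prems(4,5)[of "Suc i"] that by simp
    qed
    then obtain e where "0 < coeff e 0" "stieltjes_chain e ?u'' ?u'" by blast
    with stieltjes_chain.step[OF this(2) c(1)] show ?thesis
      unfolding u[symmetric] by blast
  qed
qed

lemma degree_v_le: "degree v \<le> n"
proof -
  have "degree (\<Prod>i<n. [:1, x i:]) \<le> (\<Sum>i<n. degree [:1, x i:])"
    using degree_prod_sum_le[of "{..<n}" "\<lambda>i. [:1, x i:]"] by (simp add: comp_def)
  also have "\<dots> \<le> (\<Sum>i<n. 1)" by (rule sum_mono) simp
  finally show ?thesis by (simp add: v_def)
qed

lemma stieltjes_chain_log_deriv:
  assumes "0 < n"
  shows "\<exists>e. 0 < coeff e 0 \<and> stieltjes_chain e (smult (real n) v - pCons 0 (pderiv v)) v"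
proof -
  define c where "c = 1 / real n"
  have c: "0 < c" using assms by (simp add: c_def)
  let ?u' = "U (\<lambda>j. y j ^ Suc 0 * (c * y j))" and ?u = "U (\<lambda>j. y j ^ 0 * 1)"
  have u: "?u = smult (real n) v - pCons 0 (pderiv v)" by (simp add: log_deriv)
  have y2: "j < n \<Longrightarrow> x j = y j * y j" for j
    by (simp add: y_def x_nonneg)
  have "?u' = smult c (U x)"
    unfolding U_def smult_sum_right by (rule sum.cong) (auto simp: y2 algebra_simps)
  moreover have "U (\<lambda>_. 1) = smult (real n) v - pCons 0 (U x)"
    using U_shift[of "\<lambda>_. 1"] by (simp add: L_def)
  ultimately have v: "v = smult c ?u + pCons 0 ?u'"
    using assms by (simp add: smult_diff_right c_def smult_add_right)
  have "\<exists>e. 0 < coeff e 0 \<and> stieltjes_chain e ?u' ?u"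
  proof (rule stieltjes_chain_orth_fun)
    show "orth_fun 0 (\<lambda>_. 1)" by (auto simp: orth_fun_def orth_def intro!: exI[of _ 1])
    show "orth_fun (Suc 0) (\<lambda>j. c * y j)"
      using c by (auto simp: orth_fun_def orth_def L_scale mult.assoc L_y intro!: exI[of _ c])
    show "0 < L 0 (\<lambda>_. 1)" using assms by (simp add: L_def)
    show u0: "coeff ?u i = 0" if "2 * n \<le> 2 * i" for i
    proof (cases "i = n")
      case True
      then show ?thesis unfolding u using assms by (cases i) (auto simp: coeff_pderiv)
    next
      case False
      then have "degree v < i" using degree_v_le that by simp
      then show ?thesis unfolding u by (cases i) (auto simp: coeff_pderiv coeff_eq_0)
    qed
    show "coeff ?u' i = 0" if "2 * n \<le> 2 * i + 1" for i
    proof -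
      have "coeff v (Suc i) = 0" using degree_v_le that by (intro coeff_eq_0) simp
      moreover have "coeff ?u (Suc i) = 0" using u0[of "Suc i"] that by simp
      ultimately show ?thesis using arg_cong[OF v, of "\<lambda>p. coeff p (Suc i)"] by simp
    qed
  qed
  then obtain e where "0 < coeff e 0" "stieltjes_chain e ?u' ?u" by blast
  then have "stieltjes_chain e ?u v" using stieltjes_chain.step[of e ?u' ?u c] c v by simp
  then show ?thesis using \<open>0 < coeff e 0\<close> u by auto
qed

end

subsection \<open>From total nonnegativity to the continued fraction\<close>

definition unit_lower_equiv :: "(nat \<Rightarrow> 'b \<Rightarrow> real) \<Rightarrow> (nat \<Rightarrow> 'b \<Rightarrow> real) \<Rightarrow> bool" where
  "unit_lower_equiv A G \<longleftrightarrow> (\<exists>m. \<forall>i s. A i s = G i s + (\<Sum>l<i. m i l * G l s))"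

lemma unit_lower_equiv_trans:
  assumes "unit_lower_equiv A H" "unit_lower_equiv H G"
  shows "unit_lower_equiv A G"
proof -
  obtain m m' where m: "\<And>i s. A i s = H i s + (\<Sum>l<i. m i l * H l s)"
    and m': "\<And>i s. H i s = G i s + (\<Sum>l<i. m' i l * G l s)"
    using assms unfolding unit_lower_equiv_def by blast
  define M where "M i q = m' i q + m i q + (\<Sum>l<i. if q < l then m i l * m' l q else 0)" for i q :: nat
  have "A i s = G i s + (\<Sum>q<i. M i q * G q s)" for i s
  proof -
    have "(\<Sum>l<i. m i l * (\<Sum>q<l. m' l q * G q s)) =
        (\<Sum>l<i. \<Sum>q<i. if q < l then m i l * m' l q * G q s else 0)"
    proof (rule sum.cong[OF refl])
      fix l assume "l \<in> {..<i}"
      then have "{q \<in> {..<i}. q < l} = {..<l}" by auto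
      then show "m i l * (\<Sum>q<l. m' l q * G q s) = (\<Sum>q<i. if q < l then m i l * m' l q * G q s else 0)"
        by (simp add: sum.inter_filter[symmetric] sum_distrib_left mult.assoc)
    qed
    also have "\<dots> = (\<Sum>q<i. \<Sum>l<i. if q < l then m i l * m' l q * G q s else 0)"
      by (rule sum.swap)
    also have "\<dots> = (\<Sum>q<i. (\<Sum>l<i. if q < l then m i l * m' l q else 0) * G q s)"
      by (auto intro!: sum.cong simp: sum_distrib_right)
    finally have swap: "(\<Sum>l<i. m i l * (\<Sum>q<l. m' l q * G q s)) =
        (\<Sum>q<i. (\<Sum>l<i. if q < l then m i l * m' l q else 0) * G q s)" .
    have "A i s = G i s + (\<Sum>q<i. m' i q * G q s) + (\<Sum>q<i. m i q * G q s) +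
        (\<Sum>l<i. m i l * (\<Sum>q<l. m' l q * G q s))"
      by (subst m, subst (1 2) m') (simp add: distrib_left sum.distrib)
    then show ?thesis
      unfolding swap M_def by (simp add: distrib_right sum.distrib)
  qed
  then show ?thesis unfolding unit_lower_equiv_def by blast
qed

lemma interlaced_unit_lower_equiv_step:
  assumes v: "v = smult c u + pCons 0 u'"
  shows "unit_lower_equiv (\<lambda>i j. interlaced u v (int i) (int j))
    (\<lambda>i j. case i of 0 \<Rightarrow> interlaced u v 0 (int j) | Suc l \<Rightarrow> interlaced u' u (int l) (int j - 1))"
    (is "unit_lower_equiv ?H ?G")
proof -
  have row_odd: "?H (Suc (2 * l)) j = ?G (Suc (2 * l)) j + c * ?H (2 * l) j" for l j
    by (simp add: interlaced_def v algebra_simps)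
  have row_even: "?H (2 * l) j = ?G (2 * l) j" for l j
    by (cases l) (simp_all add: interlaced_def algebra_simps)
  have "?H i j = ?G i j + (\<Sum>l<i. (if odd i \<and> Suc l = i then c else 0) * ?G l j)" for i j
  proof (cases "even i")
    case True
    then show ?thesis using row_even[of "i div 2" j] by simp
  next
    case False
    then obtain l where l: "i = Suc (2 * l)" by (elim oddE) auto
    have "(\<Sum>q<i. (if odd i \<and> Suc q = i then c else 0) * ?G q j) =
        (\<Sum>q<i. if q = 2 * l then c * ?G (2 * l) j else 0)"
      by (rule sum.cong) (auto simp: l)
    also have "\<dots> = c * ?G (2 * l) j" by (simp add: l)
    finally show ?thesis using row_odd[of l j] row_even[of l j] unfolding l by simp
  qed
  then show ?thesis
    unfolding unit_lower_equiv_def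
    by (intro exI[of _ "\<lambda>i l. if odd i \<and> Suc l = i then c else 0"]) blast
qed

lemma stieltjes_chain_of_tnn_section:
  assumes "tnn_on {..<N} {..<N} B"
    and "unit_lower_equiv B (\<lambda>i j. interlaced u v (int i) (int j))"
    and "0 < coeff v 0"
    and "\<And>i. N \<le> 2 * i \<Longrightarrow> coeff u i = 0"
    and "\<And>i. N < 2 * i \<Longrightarrow> coeff v i = 0"
  shows "\<exists>e. stieltjes_chain e u v"
  using assms
proof (induction N arbitrary: u v B)
  case 0
  then have "u = 0" by (intro poly_eqI) simp
  then show ?case using stieltjes_chain.base by blast
next
  case (Suc N)
  let ?H = "\<lambda>i j. interlaced u v (int i) (int j)"
  obtain m where m: "\<And>i j. B i j = ?H i j + (\<Sum>l<i. m i l * ?H l j)"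
    using Suc.prems(2) unfolding unit_lower_equiv_def by blast
  have B0: "B 0 j = coeff u j" for j by (simp add: m interlaced_def icoeff_def)
  show ?case
  proof (cases "coeff u 0 = 0")
    case True
    have "coeff u j = 0" for j
    proof (cases "0 < j \<and> j \<le> N")
      case j: True
      have "B 1 0 = coeff v 0" using True by (simp add: m interlaced_def icoeff_def)
      moreover have "B 0 j * B 1 0 \<le> B 0 0 * B 1 j"
        by (rule tnn_on_minor2[OF Suc.prems(1)]) (use j in auto)
      moreover have "0 \<le> B 0 j" by (rule tnn_on_nonneg[OF Suc.prems(1)]) (use j in auto)
      ultimately show ?thesis using True Suc.prems(3) by (auto simp: B0 mult_le_0_iff)
    next
      case False
      then show ?thesis using True Suc.prems(4)[of j] by (cases "j = 0") auto
    qed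
    then have "u = 0" by (intro poly_eqI) simp
    then show ?thesis using stieltjes_chain.base by blast
  next
    case False
    moreover have "0 \<le> B 0 0" by (rule tnn_on_nonneg[OF Suc.prems(1)]) auto
    ultimately have u0: "0 < coeff u 0" by (simp add: B0)
    define c where "c = coeff v 0 / coeff u 0"
    have c: "0 < c" using u0 Suc.prems(3) by (simp add: c_def)
    obtain d u' where du': "v - smult c u = pCons d u'" by (rule pCons_cases)
    have "d = 0" using arg_cong[OF du', of "\<lambda>p. coeff p 0"] u0 by (simp add: c_def)
    with du' have v: "v = smult c u + pCons 0 u'" by (simp add: algebra_simps)
    let ?S = "\<lambda>i j. B (Suc i) (Suc j) - B (Suc i) 0 * B 0 (Suc j) / B 0 0"
    let ?G = "\<lambda>i j. case i of 0 \<Rightarrow> interlaced u v 0 (int j) | Suc l \<Rightarrow> interlaced u' u (int l) (int j - 1)"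
    let ?H' = "\<lambda>i j. interlaced u' u (int i) (int j)"
    have "unit_lower_equiv B ?G"
      by (rule unit_lower_equiv_trans[OF Suc.prems(2) interlaced_unit_lower_equiv_step[OF v]])
    then obtain g where g: "\<And>i j. B i j = ?G i j + (\<Sum>l<i. g i l * ?G l j)"
      unfolding unit_lower_equiv_def by blast
    have BS: "B (Suc i) j = interlaced u' u (int i) (int j - 1) + g (Suc i) 0 * coeff u j +
        (\<Sum>l<i. g (Suc i) (Suc l) * interlaced u' u (int l) (int j - 1))" for i j
      by (subst g) (simp add: sum.lessThan_Suc_shift interlaced_def icoeff_def del: sum.lessThan_Suc)
    have neg: "interlaced u' u (int l) (- 1) = 0" for l
      by (simp add: interlaced_def icoeff_def)
    have Bcol: "B (Suc i) 0 = g (Suc i) 0 * coeff u 0" for i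
      by (simp add: BS neg)
    have "?S i j = ?H' i j + (\<Sum>l<i. g (Suc i) (Suc l) * ?H' l j)" for i j
      using u0 by (simp add: BS[of i "Suc j"] Bcol B0)
    then have S: "unit_lower_equiv ?S ?H'"
      unfolding unit_lower_equiv_def by (intro exI[of _ "\<lambda>i l. g (Suc i) (Suc l)"]) blast
    have "\<exists>e. stieltjes_chain e u' u"
    proof (rule Suc.IH)
      show "tnn_on {..<N} {..<N} ?S"
        by (rule tnn_on_schur_complement[OF Suc.prems(1)]) (simp add: B0 u0)
      show "coeff u i = 0" if "N < 2 * i" for i using Suc.prems(4) that by simp
      show "coeff u' i = 0" if "N \<le> 2 * i" for i
        using arg_cong[OF v, of "\<lambda>p. coeff p (Suc i)"] Suc.prems(4,5)[of "Suc i"] that by simp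
    qed (fact S, fact u0)
    then show ?thesis unfolding v using stieltjes_chain.step[OF _ c] by blast
  qed
qed

subsection \<open>Real-rootedness\<close>

lemma acoeff_eq_icoeff: "acoeff p k = icoeff (reflect_poly p) k"
  by (auto simp: acoeff_def icoeff_def coeff_reflect_poly)

definition log_deriv_num :: "real poly \<Rightarrow> real poly" where
  "log_deriv_num p = smult (real (degree p)) (reflect_poly p) - pCons 0 (pderiv (reflect_poly p))"

lemma coeff_log_deriv_num:
  "coeff (log_deriv_num p) k = (real (degree p) - real k) * coeff (reflect_poly p) k"
  by (cases k) (simp_all add: log_deriv_num_def coeff_pderiv algebra_simps)

lemma D_mat_eq_interlaced:
  "D_mat p = mat (2 * degree p) (2 * degree p)
     (\<lambda>(i, j). interlaced (log_deriv_num p) (reflect_poly p) (int i) (int j))"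
proof (rule eq_matI)
  fix i j assume "i < dim_row (mat (2 * degree p) (2 * degree p)
     (\<lambda>(i, j). interlaced (log_deriv_num p) (reflect_poly p) (int i) (int j)))"
    "j < dim_col (mat (2 * degree p) (2 * degree p)
     (\<lambda>(i, j). interlaced (log_deriv_num p) (reflect_poly p) (int i) (int j)))"
  then show "D_mat p $$ (i, j) = mat (2 * degree p) (2 * degree p)
     (\<lambda>(i, j). interlaced (log_deriv_num p) (reflect_poly p) (int i) (int j)) $$ (i, j)"
    by (auto simp: D_mat_def Let_def interlaced_def acoeff_eq_icoeff icoeff_def coeff_log_deriv_num
        of_nat_diff nat_diff_distrib zdiv_int algebra_simps)
qed (simp_all add: D_mat_def)

lemma totally_nonnegative_D_mat_iff:
  "totally_nonnegative (D_mat p) \<longleftrightarrow> tnn_on {..<2 * degree p} {..<2 * degree p}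
     (\<lambda>i j. interlaced (log_deriv_num p) (reflect_poly p) (int i) (int j))"
  unfolding totally_nonnegative_iff_tnn_on D_mat_eq_interlaced
  by (auto intro: tnn_on_compose[where f = id and g = id] simp: strict_mono_on_def)

lemma poly_reflect_cpoly:
  assumes "z \<noteq> 0"
  shows "poly (cpoly (reflect_poly p)) z = z ^ degree p * poly (cpoly p) (inverse z)"
proof -
  have "cpoly (reflect_poly p) = reflect_poly (cpoly p)"
    by (rule poly_eqI) (simp add: coeff_reflect_poly coeff_map_poly degree_map_poly)
  then show ?thesis
    using poly_reflect_poly_nz[OF assms, of "cpoly p"] by (simp add: degree_map_poly)
qed

lemma poly_cpoly_of_real: "poly (cpoly p) (of_real x) = of_real (poly p x)"
  by (induction p) simp_all

lemma poly_cpoly_cnj: "poly (cpoly p) (cnj z) = cnj (poly (cpoly p) z)"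
  by (induction p) simp_all

lemma cpoly_pderiv: "cpoly (pderiv p) = pderiv (cpoly p)"
  by (rule poly_eqI) (simp add: coeff_map_poly coeff_pderiv)

lemma cpoly_mult: "cpoly (p * q) = cpoly p * cpoly q"
  by (rule poly_eq_poly_eq_iff[THEN iffD1]) (simp add: fun_eq_iff)

lemma product_of_negative_roots:
  fixes q :: "real poly"
  assumes "0 < coeff q 0"
    and "\<And>z. poly (cpoly q) z = 0 \<Longrightarrow> z \<in> \<real> \<and> Re z \<le> 0"
  shows "\<exists>ys. q = smult (coeff q 0) (\<Prod>y\<leftarrow>ys. [:1, y:]) \<and> (\<forall>y\<in>set ys. 0 \<le> y) \<and> length ys = degree q"
  using assms
proof (induction "degree q" arbitrary: q)
  case 0
  then obtain a where "q = [:a:]" using degree_eq_zeroE by metis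
  then show ?case by (intro exI[of _ "[]"]) simp
next
  case (Suc k)
  have "\<not> constant (poly (cpoly q))"
    using Suc.hyps(2) by (simp add: constant_degree degree_map_poly)
  then obtain z where z: "poly (cpoly q) z = 0"
    using fundamental_theorem_of_algebra by blast
  then obtain x where x: "z = of_real x" "x \<le> 0"
    using Suc.prems(2)[OF z] by (metis Reals_cases Re_complex_of_real)
  have root: "poly q x = 0" using z poly_cpoly_of_real[of q x] x by simp
  have "x \<noteq> 0" using root Suc.prems(1) by (auto simp: poly_0_coeff_0)
  with x have x0: "x < 0" by simp
  obtain r where r: "q = [:- x, 1:] * r"
    using root by (auto simp: poly_eq_0_iff_dvd elim: dvdE)
  define y where "y = - 1 / x"
  have y: "0 < y" using x0 by (simp add: y_def)
  define s where "s = smult (- x) r"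
  have "[:- x, 1:] = smult (- x) [:1, y:]" using x0 by (simp add: y_def)
  then have s: "q = [:1, y:] * s"
    unfolding r s_def by (metis mult_smult_left mult_smult_right)
  have "r \<noteq> 0" using Suc.prems(1) r by auto
  then have deg: "degree s = k" "s \<noteq> 0"
    using Suc.hyps(2) x0 degree_mult_eq[of "[:- x, 1:]" r] unfolding r s_def by auto
  have c0: "coeff s 0 = coeff q 0" by (simp add: s)
  have "\<exists>ys. s = smult (coeff s 0) (\<Prod>y\<leftarrow>ys. [:1, y:]) \<and> (\<forall>y\<in>set ys. 0 \<le> y) \<and> length ys = degree s"
  proof (rule Suc.hyps(1))
    show "0 < coeff s 0" using c0 Suc.prems(1) by simp
    show "z \<in> \<real> \<and> Re z \<le> 0" if "poly (cpoly s) z = 0" for z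
      using Suc.prems(2)[of z] that unfolding s by (simp del: mult_pCons_left)
  qed (simp add: deg)
  then obtain ys where ys: "s = smult (coeff s 0) (\<Prod>y\<leftarrow>ys. [:1, y:])"
    "\<forall>y\<in>set ys. 0 \<le> y" "length ys = degree s" by blast
  have "q = smult (coeff q 0) (\<Prod>y\<leftarrow>y # ys. [:1, y:])"
    using ys(1) by (subst s) (simp add: c0 mult_smult_right del: mult_pCons_left)
  then show ?case
    using ys deg y Suc.hyps(2) by (intro exI[of _ "y # ys"]) auto
qed

lemma stieltjes_chain_of_real_rooted:
  assumes n: "1 \<le> degree p" and a: "0 < lead_coeff p"
    and roots: "\<And>z. poly (cpoly p) z = 0 \<Longrightarrow> z \<in> \<real> \<and> Re z \<le> 0"
  shows "\<exists>e. stieltjes_chain e (log_deriv_num p) (reflect_poly p) \<and> tnn_on UNIV UNIV (interlaced 0 e)"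
proof -
  let ?v = "reflect_poly p" and ?n = "degree p"
  have rroots: "z \<in> \<real> \<and> Re z \<le> 0" if "poly (cpoly ?v) z = 0" for z
  proof (cases "z = 0")
    case False
    then have "inverse z \<in> \<real> \<and> Re (inverse z) \<le> 0"
      using roots[of "inverse z"] that by (simp add: poly_reflect_cpoly)
    then obtain r where "inverse z = of_real r" "r \<le> 0" by (metis Reals_cases Re_complex_of_real)
    then have "z = of_real (inverse r)" by (metis inverse_inverse_eq of_real_inverse)
    then show ?thesis using \<open>r \<le> 0\<close> by (simp flip: of_real_inverse)
  qed simp
  have "\<exists>ys. ?v = smult (coeff ?v 0) (\<Prod>y\<leftarrow>ys. [:1, y:]) \<and> (\<forall>y\<in>set ys. 0 \<le> y) \<and> length ys = degree ?v"
    by (rule product_of_negative_roots) (use a rroots in auto)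
  then obtain ys where ys: "?v = smult (lead_coeff p) (\<Prod>y\<leftarrow>ys. [:1, y:])" "\<forall>y\<in>set ys. 0 \<le> y"
    "length ys = degree ?v" unfolding coeff_0_reflect_poly by blast
  have len: "length ys \<le> ?n" using ys(3) degree_reflect_poly_le[of p] by simp
  define x where "x j = (if j < length ys then ys ! j else 0)" for j
  interpret nonneg_reciprocal_roots ?n x "lead_coeff p"
    by unfold_locales (use a ys(2) in \<open>auto simp: x_def\<close>)
  have "(\<Prod>i<?n. [:1, x i:]) = (\<Prod>i<length ys. [:1, x i:])"
    by (rule prod.mono_neutral_right) (use len in \<open>auto simp: x_def\<close>)
  also have "\<dots> = (\<Prod>y\<leftarrow>ys. [:1, y:])"
    by (simp add: prod.list_conv_set_nth x_def lessThan_atLeast0)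
  finally have "v = ?v" by (simp add: v_def ys(1)[symmetric])
  with stieltjes_chain_log_deriv n obtain e where e: "0 < coeff e 0"
    "stieltjes_chain e (log_deriv_num p) ?v" by (auto simp: log_deriv_num_def)
  have "e dvd ?v" using stieltjes_chain_dvd[OF e(2)] by simp
  then have "z \<in> \<real> \<and> Re z \<le> 0" if "poly (cpoly e) z = 0" for z
    using rroots[of z] that by (auto elim!: dvdE)
  from product_of_negative_roots[OF e(1) this] obtain zs where
    zs: "e = smult (coeff e 0) (\<Prod>y\<leftarrow>zs. [:1, y:])" "\<forall>y\<in>set zs. 0 \<le> y" by blast
  have "tnn_on UNIV UNIV (interlaced 0 e)"
    using tnn_interlaced_product[of "coeff e 0" zs] zs e(1) by simp
  with e(2) show ?thesis by blast
qed

lemma no_root_upper_half_plane_of_stieltjes_chain: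
  assumes "stieltjes_chain e (smult c q - pCons 0 (pderiv q)) q" "q \<noteq> 0" "0 < Im t"
  shows "poly (cpoly q) t \<noteq> 0"
proof
  assume root: "poly (cpoly q) t = 0"
  obtain a b where ab: "smult c q - pCons 0 (pderiv q) = e * a" "q = e * b"
    and bt: "poly (cpoly b) t \<noteq> 0"
    using stieltjes_chain_nevanlinna[OF assms(1)] assms(3) by blast
  have t0: "t \<noteq> 0" using assms(3) by auto
  let ?q = "cpoly q" and ?k = "order t (cpoly q)"
  have q0: "?q \<noteq> 0" using assms(2) by (simp add: map_poly_eq_0_iff)
  have "pCons 0 (pderiv q) = e * (smult c b - a)"
    using ab by (simp add: algebra_simps)
  then have "e dvd [:0, 1:] * pderiv q" by simp
  then obtain w where "[:0, 1:] * pderiv q = e * w" ..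
  from arg_cong[OF this, of cpoly] have dvd: "cpoly e dvd [:0, 1:] * pderiv ?q"
    unfolding cpoly_mult cpoly_pderiv by (simp add: map_poly_pCons)
  have "order t (cpoly b) = 0" using bt by (simp add: order_0I)
  then have "order t (cpoly e) = ?k"
    using q0 unfolding ab(2) cpoly_mult by (simp add: order_mult)
  then have "[:- t, 1:] ^ ?k dvd [:0, 1:] * pderiv ?q"
    using dvd order_1[of t "cpoly e"] dvd_trans by metis
  moreover have pd: "pderiv ?q \<noteq> 0"
  proof
    assume "pderiv ?q = 0"
    then obtain d where "?q = [:d:]" by (auto simp: pderiv_eq_0_iff elim: degree_eq_zeroE)
    then show False using root q0 by simp
  qed
  ultimately have "?k \<le> order t ([:0, 1:] * pderiv ?q)"
    unfolding order_divides by (metis mult_eq_0_iff one_neq_zero pCons_eq_0_iff)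
  also have "\<dots> = order t (pderiv ?q)"
    using t0 pd by (subst order_mult) (auto simp: order_0I)
  finally have "?k \<le> order t (pderiv ?q)" .
  moreover have "?k = Suc (order t (pderiv ?q))"
    by (rule order_pderiv[OF q0]) (use root q0 in \<open>simp add: order_root\<close>)
  ultimately show False by simp
qed

lemma real_rooted_of_tnn:
  assumes n: "1 \<le> degree p" and a: "0 < lead_coeff p"
    and tnn: "tnn_on {..<2 * degree p} {..<2 * degree p}
      (\<lambda>i j. interlaced (log_deriv_num p) (reflect_poly p) (int i) (int j))"
    and z: "poly (cpoly p) z = 0"
  shows "z \<in> \<real> \<and> Re z \<le> 0"
proof -
  let ?v = "reflect_poly p"
  have "unit_lower_equiv A A" for A :: "nat \<Rightarrow> nat \<Rightarrow> real"
    unfolding unit_lower_equiv_def by (rule exI[of _ "\<lambda>_ _. 0"]) simp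
  then have "\<exists>e. stieltjes_chain e (log_deriv_num p) ?v"
    by (rule stieltjes_chain_of_tnn_section[OF tnn])
      (use a in \<open>auto simp: coeff_log_deriv_num coeff_reflect_poly\<close>)
  then obtain e where "stieltjes_chain e (log_deriv_num p) ?v" ..
  then have upper: "poly (cpoly ?v) t \<noteq> 0" if "0 < Im t" for t
    using no_root_upper_half_plane_of_stieltjes_chain that a unfolding log_deriv_num_def by force
  have "Im z = 0"
  proof (rule ccontr)
    assume im: "Im z \<noteq> 0"
    define w where "w = (if 0 < Im z then cnj z else z)"
    have w: "Im w < 0" "w \<noteq> 0" "poly (cpoly p) w = 0"
      using im z by (auto simp: w_def poly_cpoly_cnj)
    then have "0 < Im (inverse w)"
      by (simp add: divide_neg_pos sum_power2_gt_zero_iff)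
    moreover have "poly (cpoly ?v) (inverse w) = 0"
      using w by (simp add: poly_reflect_cpoly)
    ultimately show False using upper by blast
  qed
  then obtain x where x: "z = of_real x" by (metis complex_is_Real_iff Reals_cases)
  have coeffs: "0 \<le> coeff p k" if "k \<le> degree p" for k
  proof -
    have "0 \<le> interlaced (log_deriv_num p) ?v (int 1) (int (degree p - k))"
      by (rule tnn_on_nonneg[OF tnn]) (use n in auto)
    then show ?thesis using that by (simp add: interlaced_def icoeff_def coeff_reflect_poly flip: of_nat_diff split: if_splits)
  qed
  have "x \<le> 0"
  proof (rule ccontr)
    assume "\<not> x \<le> 0"
    then have "0 < (\<Sum>k\<le>degree p. coeff p k * x ^ k)"
      using a coeffs by (intro sum_pos2[of _ "degree p"]) auto
    then have "poly p x \<noteq> 0" by (simp add: poly_altdef)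
    then show False using z poly_cpoly_of_real[of p x] x by simp
  qed
  then show ?thesis using x by simp
qed

theorem theorem4p25:
  fixes p :: "real poly" and n :: nat
  assumes "n \<ge> 1" and "degree p = n" and "acoeff p 0 > 0"
  shows "(\<forall>z :: complex. poly (map_poly complex_of_real p) z = 0 \<longrightarrow> z \<in> \<real> \<and> Re z \<le> 0)
         \<longleftrightarrow> totally_nonnegative (D_mat p)"
proof -
  have n: "1 \<le> degree p" and a: "0 < lead_coeff p"
    using assms by (auto simp: acoeff_def)
  show ?thesis
    unfolding totally_nonnegative_D_mat_iff
  proof (intro iffI allI impI)
    assume "\<forall>z. poly (cpoly p) z = 0 \<longrightarrow> z \<in> \<real> \<and> Re z \<le> 0"
    then obtain e where "stieltjes_chain e (log_deriv_num p) (reflect_poly p)"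
      "tnn_on UNIV UNIV (interlaced 0 e)"
      using stieltjes_chain_of_real_rooted[OF n a] by blast
    then have "tnn_on UNIV UNIV (interlaced (log_deriv_num p) (reflect_poly p))"
      by (rule stieltjes_chain_tnn)
    then show "tnn_on {..<2 * degree p} {..<2 * degree p}
        (\<lambda>i j. interlaced (log_deriv_num p) (reflect_poly p) (int i) (int j))"
      by (rule tnn_on_compose[where f = int and g = int]) (auto simp: strict_mono_on_def)
  qed (rule real_rooted_of_tnn[OF n a])
qed

end
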